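(* For an arbitrary finite-state channel with $|\mathcal S|$ states and time-invariant deterministic feedback $z_i=z(y_i)$, for any positive integer $N$ and any positive $R$, there exists an $(N,M)$ code with $M=\lfloor2^{NR}\rfloor$ for which, for all messages $m$, $1\le m\le M$, all initial states $s_0$, and all $\rho$, $0\le\rho\le1$, the probability of error is bounded as $$P_{e,m}(s_0)\le4|\mathcal S|\,2^{-N[-\rho R+F_N(\rho)]},$$ where $$F_N(\rho)=-\frac{\rho\log|\mathcal S|}{N}+\max_{Q(x^N\|z^{N-1})}\left[\min_{s_0}E_{o,N}(\rho,Q(x^N\|z^{N-1}),s_0)\right],$$ $$E_{o,N}(\rho,Q(x^N\|z^{N-1}),s_0)=-\frac1N\log\sum_{y^N}\left[\sum_{x^N}Q(x^N\|z^{N-1})P(y^N\|x^N,s_0)^{\frac1{1+\rho}}\right]^{1+\rho}.$$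
   Context: Finite-state channel (FSC): finite input, output and state alphabets $\mathcal X,\mathcal Y,\mathcal S$ and a time-invariant kernel $P(y_i,s_i|x_i,s_{i-1})$ with $P(y_i,s_i|x^i,s^{i-1},y^{i-1})=P(y_i,s_i|x_i,s_{i-1})$; $s_0$ is the initial state. Notation: $x^i=(x_1,\dots,x_i)$. Logarithms are to base 2. Feedback: $z:\mathcal Y\to\mathcal Z$ is a fixed function into a finite set, $z_i=z(y_i)$; at time $i$ the encoder knows $z^{i-1}$. In the sums, $z^{N-1}=(z(y_1),\dots,z(y_{N-1}))$. An $(N,M)$ code consists of encoding functions $x_i(m,z^{i-1})$, $i=1,\dots,N$, $m\in\{1,\dots,M\}$, and a decoder $\hat m(y^N)$. $P_{e,m}(s_0)$ is the probability that $\hat m(Y^N)\ne m$ when $m$ is sent and the initial state is $s_0$. Causal conditioning: $Q(x^N\|z^{N-1})=\prod_{i=1}^N Q(x_i|x^{i-1},z^{i-1})$ with arbitrary conditional pmfs as factors (the maximum is over all such families); $P(y^N\|x^N,s_0)=\prod_{i=1}^N P(y_i|x^i,y^{i-1},s_0)=\sum_{s^N}\prod_{i=1}^N P(y_i,s_i|x_i,s_{i-1})$. *)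

theory Defs
  imports "HOL-Probability.Probability"
begin

text \<open>
  A finite-state channel is given by its time-invariant kernel: \<open>P x s\<close> is the joint law of the
  next output and the next state, given the current input \<open>x\<close> and the previous state \<open>s\<close>.
\<close>

type_synonym ('x, 'y, 's) fsc = "'x \<Rightarrow> 's \<Rightarrow> ('y \<times> 's) pmf"

text \<open>
  The encoder for a fixed message is a map \<open>f\<close> from feedback strings to inputs. The time index is
  carried by the length of the argument: the input at time \<open>i\<close> is \<open>f\<close> applied to the list
  \<open>[z y\<^sub>1, \<dots>, z y\<^sub>i\<^sub>-\<^sub>1]\<close>. The result of \<open>fsc_run\<close> is the joint law of the output string
  \<open>[y\<^sub>1, \<dots>, y\<^sub>n]\<close> and the state after \<open>n\<close> channel uses.
\<close>

primrec fsc_run ::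
  "('x, 'y, 's) fsc \<Rightarrow> ('y \<Rightarrow> 'z) \<Rightarrow> ('z list \<Rightarrow> 'x) \<Rightarrow> 's \<Rightarrow> nat \<Rightarrow> ('y list \<times> 's) pmf"
where
  "fsc_run P z f s0 0 = return_pmf ([], s0)"
| "fsc_run P z f s0 (Suc n) =
     bind_pmf (fsc_run P z f s0 n) (\<lambda>(ys, s).
       map_pmf (\<lambda>(y, s'). (ys @ [y], s')) (P (f (map z ys)) s))"

text \<open>
  In a code \<open>(enc, dec)\<close> of block length \<open>N\<close> with \<open>M\<close> messages, only the values \<open>enc m zs\<close> with
  \<open>m \<in> {1..M}\<close> and \<open>length zs < N\<close> and the values \<open>dec ys\<close> with \<open>length ys = N\<close> matter.
\<close>

definition is_code :: "nat \<Rightarrow> nat \<Rightarrow> (nat \<Rightarrow> 'z list \<Rightarrow> 'x) \<Rightarrow> ('y list \<Rightarrow> nat) \<Rightarrow> bool" where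
  "is_code N M enc dec \<longleftrightarrow> (\<forall>ys. length ys = N \<longrightarrow> dec ys \<in> {1..M})"

definition error_prob ::
  "('x, 'y, 's) fsc \<Rightarrow> ('y \<Rightarrow> 'z) \<Rightarrow> nat \<Rightarrow> (nat \<Rightarrow> 'z list \<Rightarrow> 'x) \<Rightarrow> ('y list \<Rightarrow> nat) \<Rightarrow>
    nat \<Rightarrow> 's \<Rightarrow> real"
where
  "error_prob P z N enc dec m s0 =
     measure_pmf.prob (fsc_run P z (enc m) s0 N) {(ys, s). dec ys \<noteq> m}"

text \<open>
  A causally conditioned input distribution is a family of pmfs: \<open>Q xs zs\<close> is the law of the input
  at time \<open>i\<close> given the strings \<open>xs\<close>, \<open>zs\<close> of length \<open>i - 1\<close>. Only the members with
  \<open>length xs = length zs < N\<close> enter below. Lists are indexed from 0, so the factor with index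
  \<open>i < N\<close> belongs to time \<open>i + 1\<close>.
\<close>

definition input_prob :: "('x list \<Rightarrow> 'z list \<Rightarrow> 'x pmf) \<Rightarrow> 'x list \<Rightarrow> 'z list \<Rightarrow> real" where
  "input_prob Q xs zs = (\<Prod>i<length xs. pmf (Q (take i xs) (take i zs)) (xs ! i))"

definition output_prob :: "('x, 'y, 's) fsc \<Rightarrow> 'x list \<Rightarrow> 's \<Rightarrow> 'y list \<Rightarrow> real" where
  "output_prob P xs s0 ys =
     (\<Sum>ss | length ss = length xs.
        \<Prod>i<length xs. pmf (P (xs ! i) ((s0 # ss) ! i)) (ys ! i, ss ! i))"

definition Eo ::
  "('x, 'y, 's) fsc \<Rightarrow> ('y \<Rightarrow> 'z) \<Rightarrow> nat \<Rightarrow> real \<Rightarrow> ('x list \<Rightarrow> 'z list \<Rightarrow> 'x pmf) \<Rightarrow> 's \<Rightarrow> real"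
where
  "Eo P z N \<rho> Q s0 =
     - (1 / real N) * log 2
         (\<Sum>ys | length ys = N.
            (\<Sum>xs | length xs = N.
               input_prob Q xs (map z (take (N - 1) ys)) *
               output_prob P xs s0 ys powr (1 / (1 + \<rho>))) powr (1 + \<rho>))"

text \<open>The supremum over \<open>Q\<close> is a maximum; see \<open>Eo_max_attained\<close> below.\<close>

definition FN ::
  "('x, 'y, 's::finite) fsc \<Rightarrow> ('y \<Rightarrow> 'z) \<Rightarrow> nat \<Rightarrow> real \<Rightarrow> real"
where
  "FN P z N \<rho> =
     - (\<rho> * log 2 (real CARD('s)) / real N) + (SUP Q. MIN s0. Eo P z N \<rho> Q s0)"


lemma positive_path:
  fixes P :: "('x, 'y, 's) fsc" and Q :: "'x list \<Rightarrow> 'z list \<Rightarrow> 'x pmf"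
  shows "\<exists>xs ys ss. length xs = n \<and> length ys = n \<and> length ss = n \<and>
    (\<forall>i<n. pmf (Q (take i xs) (map z (take i ys))) (xs ! i) > 0 \<and>
           pmf (P (xs ! i) ((s0 # ss) ! i)) (ys ! i, ss ! i) > 0)"
proof (induction n)
  case 0
  show ?case by simp
next
  case (Suc n)
  then obtain xs ys ss where l: "length xs = n" "length ys = n" "length ss = n"
    and h: "\<And>i. i < n \<Longrightarrow> pmf (Q (take i xs) (map z (take i ys))) (xs ! i) > 0 \<and>
           pmf (P (xs ! i) ((s0 # ss) ! i)) (ys ! i, ss ! i) > 0"
    by blast
  obtain x where x: "x \<in> set_pmf (Q xs (map z ys))"
    using set_pmf_not_empty by fastforce
  obtain y s where ys: "(y, s) \<in> set_pmf (P x ((s0 # ss) ! n))"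
    using set_pmf_not_empty[of "P x ((s0 # ss) ! n)"] by fastforce
  have eq: "(s0 # ss @ [s]) ! i = (s0 # ss) ! i" if "i \<le> n" for i
    using that l by (cases i) (auto simp: nth_append)
  have "\<forall>i<Suc n. pmf (Q (take i (xs @ [x])) (map z (take i (ys @ [y])))) ((xs @ [x]) ! i) > 0 \<and>
           pmf (P ((xs @ [x]) ! i) ((s0 # ss @ [s]) ! i)) ((ys @ [y]) ! i, (ss @ [s]) ! i) > 0"
  proof (intro allI impI)
    fix i assume "i < Suc n"
    then consider "i < n" | "i = n" by linarith
    then show "pmf (Q (take i (xs @ [x])) (map z (take i (ys @ [y])))) ((xs @ [x]) ! i) > 0 \<and>
           pmf (P ((xs @ [x]) ! i) ((s0 # ss @ [s]) ! i)) ((ys @ [y]) ! i, (ss @ [s]) ! i) > 0"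
    proof cases
      case 1
      then show ?thesis using h[of i] l by (simp add: nth_append eq)
    next
      case 2
      then show ?thesis using x ys l by (simp add: nth_append eq pmf_positive)
    qed
  qed
  then show ?case
    using l by (intro exI[of _ "xs @ [x]"] exI[of _ "ys @ [y]"] exI[of _ "ss @ [s]"]) simp
qed

lemma finite_lists_length [simp]: "finite {xs :: 'a::finite list. length xs = n}"
  using finite_lists_length_eq[of "UNIV :: 'a set" n] by simp

lemma Eo_arg_pos:
  fixes P :: "('x::finite, 'y::finite, 's::finite) fsc" and Q :: "'x list \<Rightarrow> 'z list \<Rightarrow> 'x pmf"
  shows "(\<Sum>ys | length ys = N. (\<Sum>xs | length xs = N.
            input_prob Q xs (map z (take (N - 1) ys)) *
            output_prob P xs s0 ys powr (1 / (1 + \<rho>))) powr (1 + \<rho>)) > 0"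
proof -
  obtain xs ys ss where l: "length xs = N" "length ys = N" "length ss = N"
    and h: "\<And>i. i < N \<Longrightarrow> pmf (Q (take i xs) (map z (take i ys))) (xs ! i) > 0"
      "\<And>i. i < N \<Longrightarrow> pmf (P (xs ! i) ((s0 # ss) ! i)) (ys ! i, ss ! i) > 0"
    using positive_path[of N Q z P s0] by blast
  have 1: "input_prob Q xs (map z (take (N - 1) ys)) > 0"
    unfolding input_prob_def
  proof (rule prod_pos)
    fix i assume "i \<in> {..<length xs}"
    then have "i < N" "min i (N - 1) = i" using l by auto
    then show "pmf (Q (take i xs) (take i (map z (take (N - 1) ys)))) (xs ! i) > 0"
      using h(1)[of i] by (simp add: take_map)
  qed
  have 2: "output_prob P xs s0 ys > 0"
    unfolding output_prob_def
  proof (rule sum_pos2[where i = ss])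
    show "(\<Prod>i<length xs. pmf (P (xs ! i) ((s0 # ss) ! i)) (ys ! i, ss ! i)) > 0"
      using h(2) l by (intro prod_pos) auto
  qed (use l in \<open>auto intro: prod_nonneg\<close>)
  have 3: "(\<Sum>xs | length xs = N. input_prob Q xs (map z (take (N - 1) ys)) *
            output_prob P xs s0 ys powr (1 / (1 + \<rho>))) > 0"
    by (rule sum_pos2[where i = xs])
       (use l 1 2 in \<open>auto simp: input_prob_def intro!: mult_nonneg_nonneg prod_nonneg\<close>)
  show ?thesis
    by (rule sum_pos2[where i = ys]) (use l 3 in auto)
qed

lemma continuous_on_MIN:
  fixes f :: "'a::topological_space \<Rightarrow> 'b::finite \<Rightarrow> real"
  assumes "\<And>b. continuous_on K (\<lambda>a. f a b)"
  shows "continuous_on K (\<lambda>a. MIN b. f a b)"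
proof -
  have "continuous_on K (\<lambda>a. Min (f a ` B))" if "finite B" "B \<noteq> {}" for B
    using that
  proof (induction rule: finite_ne_induct)
    case (singleton b)
    then show ?case using assms by simp
  next
    case (insert b B)
    then show ?case using assms by (simp add: continuous_on_min)
  qed
  then show ?thesis by simp
qed

lemma compact_stochastic:
  "compact {q :: 'c \<times> 'x::finite \<Rightarrow> real. (\<forall>c x. 0 \<le> q (c, x)) \<and> (\<forall>c. (\<Sum>x\<in>UNIV. q (c, x)) = 1)}"
    (is "compact ?K")
proof -
  let ?B = "PiE UNIV (\<lambda>_. {0..1}) :: ('c \<times> 'x \<Rightarrow> real) set"
  have "compactin (product_topology (\<lambda>_. euclidean) UNIV) ?B"
    by (simp add: compactin_PiE)
  then have B: "compact ?B"
    by (simp add: euclidean_product_topology)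
  have "closed {q :: 'c \<times> 'x \<Rightarrow> real. (\<forall>c. (\<Sum>x\<in>UNIV. q (c, x)) = 1)}"
    by (intro closed_Collect_all closed_Collect_eq continuous_intros) simp_all
  moreover have "?K = ?B \<inter> {q. (\<forall>c. (\<Sum>x\<in>UNIV. q (c, x)) = 1)}"
  proof -
    have "q (c, x) \<le> 1" if "\<forall>c x. 0 \<le> q (c, x)" "\<forall>c. (\<Sum>x\<in>UNIV. q (c, x)) = 1"
      for q :: "'c \<times> 'x \<Rightarrow> real" and c x
      using that member_le_sum[of x UNIV "\<lambda>x. q (c, x)"] by simp
    then show ?thesis by (fastforce simp: PiE_def Pi_def)
  qed
  ultimately show ?thesis using B by (simp add: compact_Int_closed)
qed

lemma Eo_max_attained:
  fixes P :: "('x::finite, 'y::finite, 's::finite) fsc" and z :: "'y \<Rightarrow> 'z"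
  assumes "\<rho> \<ge> 0"
  shows "\<exists>Q. \<forall>Q'. (MIN s0. Eo P z N \<rho> Q' s0) \<le> (MIN s0. Eo P z N \<rho> Q s0)"
proof -
  define K :: "(('x list \<times> 'z list) \<times> 'x \<Rightarrow> real) set" where
    "K = {q. (\<forall>c x. 0 \<le> q (c, x)) \<and> (\<forall>c. (\<Sum>x\<in>UNIV. q (c, x)) = 1)}"
  define E where "E q s0 = - (1 / real N) * log 2
         (\<Sum>ys | length ys = N. (\<Sum>xs | length xs = N.
               (\<Prod>i<length xs. q ((take i xs, take i (map z (take (N - 1) ys))), xs ! i)) *
               output_prob P xs s0 ys powr (1 / (1 + \<rho>))) powr (1 + \<rho>))"
    for q :: "('x list \<times> 'z list) \<times> 'x \<Rightarrow> real" and s0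
  define q_of :: "('x list \<Rightarrow> 'z list \<Rightarrow> 'x pmf) \<Rightarrow> ('x list \<times> 'z list) \<times> 'x \<Rightarrow> real" where
    "q_of Q = (\<lambda>((xs, zs), x). pmf (Q xs zs) x)" for Q
  have E: "Eo P z N \<rho> Q s0 = E (q_of Q) s0" for Q s0
    by (simp add: Eo_def E_def q_of_def input_prob_def)
  have q_of_K: "q_of Q \<in> K" for Q
    by (auto simp: K_def q_of_def sum_pmf_eq_1)
  have K_q_of: "\<exists>Q. q = q_of Q" if "q \<in> K" for q
  proof -
    have "pmf (embed_pmf (\<lambda>x. q (c, x))) x = q (c, x)" for c x
    proof (rule pmf_embed_pmf)
      show "(\<integral>\<^sup>+ x. ennreal (q (c, x)) \<partial>count_space UNIV) = 1"
        using that by (cases c) (simp add: K_def nn_integral_count_space_finite sum_ennreal)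
    qed (use that in \<open>cases c, auto simp: K_def\<close>)
    then show ?thesis
      by (intro exI[of _ "\<lambda>xs zs. embed_pmf (\<lambda>x. q ((xs, zs), x))"]) (auto simp: q_of_def)
  qed
  have nonneg: "(\<Prod>i<n. q (c i, x i)) \<ge> 0" if "q \<in> K" for q c x and n :: nat
    using that unfolding K_def by (intro prod_nonneg) blast
  have coord: "continuous_on K (\<lambda>q. q j)" for j
    by (rule continuous_on_product_then_coordinatewise) (rule continuous_on_id)
  have pos: "(\<Sum>ys | length ys = N. (\<Sum>xs | length xs = N.
               (\<Prod>i<length xs. q ((take i xs, take i (map z (take (N - 1) ys))), xs ! i)) *
               output_prob P xs s0 ys powr (1 / (1 + \<rho>))) powr (1 + \<rho>)) > 0"
    if q: "q \<in> K" for q s0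
  proof -
    obtain Q where "q = q_of Q" using K_q_of[OF q] by blast
    then show ?thesis
      using Eo_arg_pos[where \<rho> = \<rho> and ?s0.0 = s0 and P = P and Q = Q and z = z and N = N] by (simp add: q_of_def input_prob_def)
  qed
  have inner: "continuous_on K (\<lambda>q. (\<Sum>xs | length xs = N.
               (\<Prod>i<length xs. q ((take i xs, take i (map z (take (N - 1) ys))), xs ! i)) *
               output_prob P xs s0 ys powr (1 / (1 + \<rho>))) powr (1 + \<rho>))" for s0 ys
  proof (rule continuous_on_powr', goal_cases)
    case 1
    show ?case by (intro continuous_on_sum continuous_on_mult continuous_on_prod coord continuous_on_const)
  next
    case 3
    show ?case
      using assms by (intro ballI conjI sum_nonneg mult_nonneg_nonneg nonneg) auto
  qed (rule continuous_on_const)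
  have "continuous_on K (\<lambda>q. E q s0)" for s0
  proof -
    have "continuous_on K (\<lambda>q. \<Sum>ys | length ys = N. (\<Sum>xs | length xs = N.
               (\<Prod>i<length xs. q ((take i xs, take i (map z (take (N - 1) ys))), xs ! i)) *
               output_prob P xs s0 ys powr (1 / (1 + \<rho>))) powr (1 + \<rho>))"
      by (intro continuous_on_sum inner)
    then show ?thesis
      unfolding E_def log_def
      by (intro continuous_on_mult continuous_on_divide continuous_on_ln continuous_on_const)
         (use pos in \<open>auto simp: less_le\<close>)
  qed
  then have "continuous_on K (\<lambda>q. MIN s0. E q s0)"
    by (rule continuous_on_MIN)
  moreover have "compact K"
    unfolding K_def by (rule compact_stochastic)
  moreover have "K \<noteq> {}" using q_of_K by blast
  ultimately obtain q where q: "q \<in> K" "\<And>q'. q' \<in> K \<Longrightarrow> (MIN s0. E q' s0) \<le> (MIN s0. E q s0)"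
    using continuous_attains_sup[of K "\<lambda>q. MIN s0. E q s0"] by blast
  obtain Q where "q = q_of Q" using K_q_of[OF q(1)] by blast
  then show ?thesis
    using q(2) q_of_K by (intro exI[of _ Q]) (simp add: E)
qed

end

theory Submission
  imports Defs
begin

text \<open>
  Gallager's random coding argument, applied to code trees. A message is encoded by a function that
  maps past inputs and past feedback to the next input; such functions turn \<open>N\<close> uses of the channel
  with feedback into one use of a channel without feedback, whose input is the tree. Maximum
  likelihood decoding is done for the channel averaged over a uniform initial state, which does not
  depend on the unknown \<open>s0\<close>; returning to a fixed \<open>s0\<close> costs the factor \<open>|S|\<close>. The
  inequalities \<open>(\<Sum>a) powr \<theta> \<le> \<Sum>(a powr \<theta>)\<close> for \<open>\<theta> = 1 / (1 + \<rho>)\<close> and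
  \<open>(\<Sum>a) powr (1 + \<rho>) \<le> |S| powr \<rho> * \<Sum>(a powr (1 + \<rho>))\<close> split the exponent of the
  averaged channel into those of the individual initial states and give the term
  \<open>\<rho> log |S| / N\<close> of \<open>F\<^sub>N\<close>.
\<close>

subsection \<open>Inequalities for real powers\<close>

text \<open>A concave power lies below its tangent at 1; this is weighted AM-GM for 1 and
  \<open>t\<close>. At \<open>t = 0\<close> the left side is 0 even for \<open>\<rho> = 0\<close>,
  since \<open>0 powr 0 = 0\<close>.\<close>

lemma powr_le_tangent:
  fixes t \<rho> :: real
  assumes "0 \<le> t" "0 \<le> \<rho>" "\<rho> \<le> 1"
  shows "t powr \<rho> \<le> 1 - \<rho> + \<rho> * t"
proof (cases "t = 0")
  case False
  then show ?thesis
    using Youngs_inequality_0[of "1 - \<rho>" \<rho> 1 t] assms by simp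
qed (use assms in simp)

text \<open>Jensen for a concave power: the tangent inequality for \<open>X a / e\<close>, with
  \<open>e\<close> the mean, is integrated. If \<open>e = 0\<close>, then \<open>X\<close> vanishes
  almost surely.\<close>

lemma expectation_powr_le:
  fixes X :: "'a \<Rightarrow> real"
  assumes fin: "finite (set_pmf p)" and X: "\<And>a. a \<in> set_pmf p \<Longrightarrow> X a \<ge> 0"
    and \<rho>: "0 \<le> \<rho>" "\<rho> \<le> 1"
  shows "measure_pmf.expectation p (\<lambda>a. X a powr \<rho>) \<le> measure_pmf.expectation p X powr \<rho>"
proof -
  define e where "e = measure_pmf.expectation p X"
  have int: "integrable (measure_pmf p) f" for f :: "'a \<Rightarrow> real"
    using fin by (rule integrable_measure_pmf_finite)
  have "e \<ge> 0"
    unfolding e_def using X by (intro integral_nonneg_AE) (simp add: AE_measure_pmf_iff)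
  show ?thesis
  proof (cases "e = 0")
    case True
    then have "AE a in measure_pmf p. X a = 0"
      using integral_nonneg_eq_0_iff_AE[OF int[of X]] X by (simp add: e_def AE_measure_pmf_iff)
    then have "measure_pmf.expectation p (\<lambda>a. X a powr \<rho>) = measure_pmf.expectation p (\<lambda>a. 0)"
      by (intro integral_cong_AE) (auto simp: AE_measure_pmf_iff)
    then show ?thesis by simp
  next
    case False
    with \<open>e \<ge> 0\<close> have e: "e > 0" by simp
    have "measure_pmf.expectation p (\<lambda>a. X a powr \<rho>)
      \<le> measure_pmf.expectation p (\<lambda>a. e powr \<rho> * (1 - \<rho> + \<rho> / e * X a))"
    proof (intro integral_mono_AE int, unfold AE_measure_pmf_iff, rule ballI)
      fix a assume "a \<in> set_pmf p"
      then have a: "X a \<ge> 0" by (rule X)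
      have "X a powr \<rho> = e powr \<rho> * (X a / e) powr \<rho>"
        using a e by (simp flip: powr_mult)
      also have "\<dots> \<le> e powr \<rho> * (1 - \<rho> + \<rho> * (X a / e))"
        using a e \<rho> by (intro mult_left_mono powr_le_tangent) auto
      finally show "X a powr \<rho> \<le> e powr \<rho> * (1 - \<rho> + \<rho> / e * X a)" by simp
    qed
    also have "\<dots> = e powr \<rho> * (1 - \<rho> + \<rho> / e * e)"
      by (simp add: int e_def)
    also have "\<dots> = e powr \<rho>" using e by simp
    finally show ?thesis by (simp add: e_def)
  qed
qed

text \<open>The fractions \<open>f a / s\<close> of the total add up to 1 and lie in [0, 1], where
  \<open>r \<le> r powr \<theta>\<close>.\<close>

lemma powr_sum_le_sum_powr:
  fixes f :: "'a \<Rightarrow> real"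
  assumes "finite A" "\<And>a. a \<in> A \<Longrightarrow> f a \<ge> 0" and \<theta>: "0 \<le> \<theta>" "\<theta> \<le> 1"
  shows "(\<Sum>a\<in>A. f a) powr \<theta> \<le> (\<Sum>a\<in>A. f a powr \<theta>)"
proof (cases "(\<Sum>a\<in>A. f a) = 0")
  case False
  define s where "s = (\<Sum>a\<in>A. f a)"
  have s: "s > 0" using False assms by (simp add: s_def less_le sum_nonneg)
  have "s powr \<theta> = (\<Sum>a\<in>A. s powr \<theta> * (f a / s))"
    using s by (simp add: s_def flip: sum_divide_distrib sum_distrib_left)
  also have "\<dots> \<le> (\<Sum>a\<in>A. f a powr \<theta>)"
  proof (rule sum_mono)
    fix a assume a: "a \<in> A"
    have "f a \<le> s" unfolding s_def using assms a by (intro member_le_sum) auto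
    then have r: "0 \<le> f a / s" "f a / s \<le> 1" using s assms a by auto
    have "f a / s \<le> (f a / s) powr \<theta>"
      using powr_mono'[of \<theta> 1 "f a / s"] r \<theta> by (simp del: abs_divide)
    then have "s powr \<theta> * (f a / s) \<le> s powr \<theta> * (f a / s) powr \<theta>"
      by (intro mult_left_mono) auto
    then show "s powr \<theta> * (f a / s) \<le> f a powr \<theta>"
      using s assms a by (simp flip: powr_mult)
  qed
  finally show ?thesis by (simp add: s_def)
qed (simp add: sum_nonneg)

text \<open>Power mean inequality: Jensen with exponent \<open>1 / (1 + \<rho>)\<close> for the
  uniform law on \<open>A\<close>, applied to the values
  \<open>f a powr (1 + \<rho>)\<close>.\<close>

lemma powr_sum_le_card_powr:
  fixes f :: "'a \<Rightarrow> real"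
  assumes A: "finite A" "A \<noteq> {}" and f: "\<And>a. a \<in> A \<Longrightarrow> f a \<ge> 0" and \<rho>: "0 \<le> \<rho>"
  shows "(\<Sum>a\<in>A. f a) powr (1 + \<rho>) \<le> card A powr \<rho> * (\<Sum>a\<in>A. f a powr (1 + \<rho>))"
proof -
  define n where "n = real (card A)"
  have n: "n > 0" using A by (simp add: n_def card_gt_0_iff)
  have "(\<Sum>a\<in>A. f a) / n = measure_pmf.expectation (pmf_of_set A) (\<lambda>a. (f a powr (1 + \<rho>)) powr (1 / (1 + \<rho>)))"
    using A f \<rho> by (simp add: integral_pmf_of_set n_def powr_powr)
  also have "\<dots> \<le> measure_pmf.expectation (pmf_of_set A) (\<lambda>a. f a powr (1 + \<rho>)) powr (1 / (1 + \<rho>))"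
    using A f \<rho> by (intro expectation_powr_le) auto
  also have "measure_pmf.expectation (pmf_of_set A) (\<lambda>a. f a powr (1 + \<rho>)) = (\<Sum>a\<in>A. f a powr (1 + \<rho>)) / n"
    using A by (simp add: integral_pmf_of_set n_def)
  finally have "((\<Sum>a\<in>A. f a) / n) powr (1 + \<rho>) \<le>
      (((\<Sum>a\<in>A. f a powr (1 + \<rho>)) / n) powr (1 / (1 + \<rho>))) powr (1 + \<rho>)"
    using f n \<rho> by (intro powr_mono2) (auto intro!: divide_nonneg_pos sum_nonneg)
  also have "\<dots> = (\<Sum>a\<in>A. f a powr (1 + \<rho>)) / n"
    using \<rho> n by (simp add: powr_powr sum_nonneg)
  finally have *: "((\<Sum>a\<in>A. f a) / n) powr (1 + \<rho>) \<le> (\<Sum>a\<in>A. f a powr (1 + \<rho>)) / n" .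
  have "(\<Sum>a\<in>A. f a) powr (1 + \<rho>) = n powr (1 + \<rho>) * ((\<Sum>a\<in>A. f a) / n) powr (1 + \<rho>)"
    using n f by (simp add: sum_nonneg flip: powr_mult)
  also have "\<dots> \<le> n powr (1 + \<rho>) * ((\<Sum>a\<in>A. f a powr (1 + \<rho>)) / n)"
    using * by (intro mult_left_mono) auto
  also have "\<dots> = n powr \<rho> * (\<Sum>a\<in>A. f a powr (1 + \<rho>))"
    using n by (simp add: powr_add)
  finally show ?thesis by (simp add: n_def)
qed

lemma expectation_pair_pmf_mult:
  fixes f g :: "_ \<Rightarrow> real"
  assumes "finite (set_pmf p)" "finite (set_pmf q)"
  shows "measure_pmf.expectation (pair_pmf p q) (\<lambda>(a, b). f a * g b) =
    measure_pmf.expectation p f * measure_pmf.expectation q g"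
proof -
  have "measure_pmf.expectation (pair_pmf p q) (\<lambda>(a, b). f a * g b) =
      (\<Sum>c\<in>set_pmf p \<times> set_pmf q. (case c of (a, b) \<Rightarrow> f a * g b) * pmf (pair_pmf p q) c)"
    using assms by (intro integral_measure_pmf_real) auto
  also have "\<dots> = (\<Sum>a\<in>set_pmf p. \<Sum>b\<in>set_pmf q. (f a * pmf p a) * (g b * pmf q b))"
    by (simp add: sum.cartesian_product split_def pmf_pair mult_ac flip: pmf_pair)
  also have "\<dots> = (\<Sum>a\<in>set_pmf p. f a * pmf p a) * (\<Sum>b\<in>set_pmf q. g b * pmf q b)"
    by (simp add: sum_product)
  also have "\<dots> = measure_pmf.expectation p f * measure_pmf.expectation q g"
    using assms by (simp add: integral_measure_pmf_real[where A = "set_pmf p"] integral_measure_pmf_real[where A = "set_pmf q"])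
  finally show ?thesis .
qed

lemma finite_set_Pi_pmf:
  assumes "finite A" "\<And>a. a \<in> A \<Longrightarrow> finite (set_pmf (p a))"
  shows "finite (set_pmf (Pi_pmf A d p))"
  using assms by (simp add: set_Pi_pmf finite_PiE_dflt)

subsection \<open>Random coding with expurgation\<close>

text \<open>
  \<open>confusion W Y I c m\<close> bounds the error probability of every maximum likelihood decoder, however
  it breaks ties, and it can only decrease when \<open>I\<close> shrinks.
\<close>

definition confusion :: "('u \<Rightarrow> 'y \<Rightarrow> real) \<Rightarrow> 'y set \<Rightarrow> 'm set \<Rightarrow> ('m \<Rightarrow> 'u) \<Rightarrow> 'm \<Rightarrow> real" where
  "confusion W Y I c m = (\<Sum>y | y \<in> Y \<and> (\<exists>m'\<in>I - {m}. W (c m) y \<le> W (c m') y). W (c m) y)"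

lemma confusion_nonneg: "(\<And>u y. W u y \<ge> 0) \<Longrightarrow> confusion W Y I c m \<ge> 0"
  unfolding confusion_def by (intro sum_nonneg) 

text \<open>Gallager's bound on the error event: at a counted output, a single rival already makes
  the ratio of the inner sum to \<open>W (c m) y powr \<theta>\<close> at least 1, and the power
  \<open>\<rho>\<close> preserves this.\<close>

lemma confusion_le:
  assumes W: "\<And>u y. W u y \<ge> 0" and fin: "finite Y" "finite I" and \<rho>: "0 \<le> \<rho>"
  shows "confusion W Y I c m \<le> (\<Sum>y\<in>Y. W (c m) y powr (1 / (1 + \<rho>)) *
            (\<Sum>m'\<in>I - {m}. W (c m') y powr (1 / (1 + \<rho>))) powr \<rho>)"
  unfolding confusion_def
proof (rule order.trans[OF sum_mono sum_mono2])
  define \<theta> where "\<theta> = 1 / (1 + \<rho>)"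
  fix y assume "y \<in> {y \<in> Y. \<exists>m'\<in>I - {m}. W (c m) y \<le> W (c m') y}"
  then obtain m' where m': "m' \<in> I - {m}" "W (c m) y \<le> W (c m') y" by blast
  have "W (c m) y powr \<theta> \<le> W (c m') y powr \<theta>"
    using m' W \<rho> by (intro powr_mono2) (auto simp: \<theta>_def)
  also have "\<dots> \<le> (\<Sum>m'\<in>I - {m}. W (c m') y powr \<theta>)"
    using m' fin by (intro member_le_sum) auto
  finally have le: "W (c m) y powr \<theta> \<le> (\<Sum>m'\<in>I - {m}. W (c m') y powr \<theta>)" .
  \<comment> \<open>Because the exponents add up to 1, the likelihood splits into a factor kept for
    the sent word and a factor to be replaced by the rivals.\<close>
  have "\<theta> + \<theta> * \<rho> = 1" using \<rho> by (simp add: \<theta>_def field_simps)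
  then have "W (c m) y = W (c m) y powr \<theta> * (W (c m) y powr \<theta>) powr \<rho>"
    using W by (simp add: powr_powr flip: powr_add)
  also have "\<dots> \<le> W (c m) y powr \<theta> * (\<Sum>m'\<in>I - {m}. W (c m') y powr \<theta>) powr \<rho>"
    using le \<rho> by (intro mult_left_mono powr_mono2) auto
  finally show "W (c m) y \<le> W (c m) y powr (1 / (1 + \<rho>)) *
            (\<Sum>m'\<in>I - {m}. W (c m') y powr (1 / (1 + \<rho>))) powr \<rho>"
    by (simp add: \<theta>_def)
qed (use fin W in auto)

text \<open>Independence of the codewords separates the factor of the sent word from that of its
  rivals. Jensen, which needs \<open>\<rho> \<le> 1\<close>, moves the expectation inside the power,
  and all \<open>card I - 1\<close> rivals have the same mean.\<close>

lemma expectation_confusion_le: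
  fixes W :: "'u \<Rightarrow> 'y \<Rightarrow> real"
  assumes W: "\<And>u y. W u y \<ge> 0" and fin: "finite Y" "finite I" "finite (set_pmf p)"
    and m: "m \<in> I" and \<rho>: "0 \<le> \<rho>" "\<rho> \<le> 1"
  shows "measure_pmf.expectation (Pi_pmf I d (\<lambda>_. p)) (\<lambda>c. confusion W Y I c m)
    \<le> real (card I - 1) powr \<rho> *
        (\<Sum>y\<in>Y. measure_pmf.expectation p (\<lambda>u. W u y powr (1 / (1 + \<rho>))) powr (1 + \<rho>))"
proof -
  define \<theta> where "\<theta> = 1 / (1 + \<rho>)"
  define J where "J = I - {m}"
  define e where "e y = measure_pmf.expectation p (\<lambda>u. W u y powr \<theta>)" for y
  let ?q = "Pi_pmf J d (\<lambda>_. p)"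
  have J: "finite J" "m \<notin> J" "I = insert m J" "card J = card I - 1"
    using fin m by (auto simp: J_def)
  have finI: "finite (set_pmf (Pi_pmf I d (\<lambda>_. p)))" and finJ: "finite (set_pmf ?q)"
    using fin J by (simp_all add: finite_set_Pi_pmf)
  have e: "e y \<ge> 0" for y unfolding e_def by (intro integral_nonneg_AE) auto
  have y: "measure_pmf.expectation (Pi_pmf I d (\<lambda>_. p))
      (\<lambda>c. W (c m) y powr \<theta> * (\<Sum>m'\<in>J. W (c m') y powr \<theta>) powr \<rho>)
      \<le> real (card I - 1) powr \<rho> * e y powr (1 + \<rho>)" for y
  proof -
    have "measure_pmf.expectation (Pi_pmf I d (\<lambda>_. p))
        (\<lambda>c. W (c m) y powr \<theta> * (\<Sum>m'\<in>J. W (c m') y powr \<theta>) powr \<rho>) =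
      measure_pmf.expectation (pair_pmf p ?q)
        (\<lambda>(u, c). W u y powr \<theta> * (\<Sum>m'\<in>J. W (c m') y powr \<theta>) powr \<rho>)"
      using J by (auto simp: Pi_pmf_insert split_def intro!: Bochner_Integration.integral_cong
        arg_cong2[where f = "(*)"] arg_cong2[where f = "(powr)"] sum.cong)
    also have "\<dots> = e y * measure_pmf.expectation ?q (\<lambda>c. (\<Sum>m'\<in>J. W (c m') y powr \<theta>) powr \<rho>)"
      unfolding e_def using fin(3) finJ by (rule expectation_pair_pmf_mult)
    also have "\<dots> \<le> e y * measure_pmf.expectation ?q (\<lambda>c. \<Sum>m'\<in>J. W (c m') y powr \<theta>) powr \<rho>"
      using e finJ \<rho> by (intro mult_left_mono expectation_powr_le) (auto intro: sum_nonneg)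
    also have "measure_pmf.expectation ?q (\<lambda>c. \<Sum>m'\<in>J. W (c m') y powr \<theta>) = real (card I - 1) * e y"
    proof -
      have "measure_pmf.expectation ?q (\<lambda>c. W (c m') y powr \<theta>) = e y" if "m' \<in> J" for m'
      proof -
        have "measure_pmf.expectation ?q (\<lambda>c. W (c m') y powr \<theta>) =
          measure_pmf.expectation (map_pmf (\<lambda>c. c m') ?q) (\<lambda>u. W u y powr \<theta>)" by simp
        also have "map_pmf (\<lambda>c. c m') ?q = p" using that J by (simp add: Pi_pmf_component)
        finally show ?thesis by (simp add: e_def)
      qed
      then show ?thesis using J finJ by (simp add: integrable_measure_pmf_finite)
    qed
    also have "e y * (real (card I - 1) * e y) powr \<rho> = real (card I - 1) powr \<rho> * e y powr (1 + \<rho>)"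
      using e by (simp add: powr_mult powr_add)
    finally show ?thesis .
  qed
  have "measure_pmf.expectation (Pi_pmf I d (\<lambda>_. p)) (\<lambda>c. confusion W Y I c m)
    \<le> measure_pmf.expectation (Pi_pmf I d (\<lambda>_. p))
      (\<lambda>c. \<Sum>y\<in>Y. W (c m) y powr \<theta> * (\<Sum>m'\<in>J. W (c m') y powr \<theta>) powr \<rho>)"
    unfolding \<theta>_def J_def
    by (intro integral_mono integrable_measure_pmf_finite finI confusion_le W fin \<rho>)
  also have "\<dots> = (\<Sum>y\<in>Y. measure_pmf.expectation (Pi_pmf I d (\<lambda>_. p))
      (\<lambda>c. W (c m) y powr \<theta> * (\<Sum>m'\<in>J. W (c m') y powr \<theta>) powr \<rho>))"
    by (intro Bochner_Integration.integral_sum integrable_measure_pmf_finite finI)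
  also have "\<dots> \<le> (\<Sum>y\<in>Y. real (card I - 1) powr \<rho> * e y powr (1 + \<rho>))"
    by (intro sum_mono y)
  finally show ?thesis by (simp add: e_def \<theta>_def sum_distrib_left)
qed

lemma exists_le_expectation:
  fixes f :: "'a \<Rightarrow> real"
  assumes "finite (set_pmf p)"
  shows "\<exists>a\<in>set_pmf p. f a \<le> measure_pmf.expectation p f"
proof (rule ccontr)
  define b where "b = Min (f ` set_pmf p)"
  assume "\<not> ?thesis"
  then have less: "measure_pmf.expectation p f < b"
    unfolding b_def using assms by (subst Min_gr_iff) (auto simp: set_pmf_not_empty not_le)
  have "measure_pmf.expectation p (\<lambda>_. b) \<le> measure_pmf.expectation p f"
    using assms by (intro integral_mono_AE integrable_measure_pmf_finite) (auto simp: AE_measure_pmf_iff b_def)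
  with less show False by simp
qed

text \<open>
  Expurgation: a good codebook with \<open>2 * M - 1\<close> words has at least \<open>M\<close> words whose confusion is
  at most twice the average. This costs a factor \<open>2 * 2 powr \<rho> \<le> 4\<close>.
\<close>

lemma exists_code_confusion_le:
  fixes W :: "'u \<Rightarrow> 'y \<Rightarrow> real"
  assumes W: "\<And>u y. W u y \<ge> 0" and fin: "finite Y" "finite (set_pmf p)"
    and M: "M \<ge> 1" and \<rho>: "0 \<le> \<rho>" "\<rho> \<le> 1"
    and A: "(\<Sum>y\<in>Y. measure_pmf.expectation p (\<lambda>u. W u y powr (1 / (1 + \<rho>))) powr (1 + \<rho>)) \<le> A"
      "A > 0"
  shows "\<exists>c. \<forall>m\<in>{1..M}. confusion W Y {1..M} c m \<le> 4 * real M powr \<rho> * A"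
proof -
  define I where "I = {1..2 * M - 1}"
  \<comment> \<open>Bounds the mean confusion of each word; the
    \<open>card I - 1 = 2 * M - 2\<close> rivals are rounded up to \<open>2 * M\<close>.\<close>
  define B where "B = real (2 * M) powr \<rho> * A"
  have I: "finite I" "card I = 2 * M - 1" by (simp_all add: I_def)
  have B: "B > 0" using M A by (simp add: B_def)
  let ?q = "Pi_pmf I undefined (\<lambda>_. p)"
  have finq: "finite (set_pmf ?q)" using I fin by (simp add: finite_set_Pi_pmf)
  have "measure_pmf.expectation ?q (\<lambda>c. \<Sum>m\<in>I. confusion W Y I c m) =
      (\<Sum>m\<in>I. measure_pmf.expectation ?q (\<lambda>c. confusion W Y I c m))"
    by (intro Bochner_Integration.integral_sum integrable_measure_pmf_finite finq)
  also have "\<dots> \<le> (\<Sum>m\<in>I. B)"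
  proof (rule sum_mono)
    fix m assume "m \<in> I"
    then have "measure_pmf.expectation ?q (\<lambda>c. confusion W Y I c m)
        \<le> real (card I - 1) powr \<rho> *
          (\<Sum>y\<in>Y. measure_pmf.expectation p (\<lambda>u. W u y powr (1 / (1 + \<rho>))) powr (1 + \<rho>))"
      using W fin I \<rho> by (intro expectation_confusion_le) auto
    also have "\<dots> \<le> real (card I - 1) powr \<rho> * A"
      using A by (intro mult_left_mono) auto
    also have "\<dots> \<le> B"
      unfolding B_def using A I \<rho> by (intro mult_right_mono powr_mono2) auto
    finally show "measure_pmf.expectation ?q (\<lambda>c. confusion W Y I c m) \<le> B" .
  qed
  also have "\<dots> = real (2 * M - 1) * B" using I by simp
  finally obtain c where c: "(\<Sum>m\<in>I. confusion W Y I c m) \<le> real (2 * M - 1) * B"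
    using exists_le_expectation[OF finq, of "\<lambda>c. \<Sum>m\<in>I. confusion W Y I c m"] order.trans by blast
  define G where "G = {m \<in> I. confusion W Y I c m \<le> 2 * B}"
  \<comment> \<open>Markov's inequality by counting: every word outside \<open>G\<close> contributes
    more than \<open>2 * B\<close> to the total.\<close>
  have "real (card (I - G)) * (2 * B) = (\<Sum>m\<in>I - G. 2 * B)" by simp
  also have "\<dots> \<le> (\<Sum>m\<in>I - G. confusion W Y I c m)"
    by (intro sum_mono) (auto simp: G_def)
  also have "\<dots> \<le> (\<Sum>m\<in>I. confusion W Y I c m)"
    using I W by (intro sum_mono2) (auto intro: confusion_nonneg)
  also have "\<dots> \<le> real (2 * M - 1) * B" by (rule c)
  finally have "(real (card (I - G)) * 2) * B \<le> real (2 * M - 1) * B" by (simp add: mult_ac)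
  then have "real (card (I - G)) * 2 \<le> real (2 * M - 1)" using B by simp
  then have "card (I - G) * 2 \<le> 2 * M - 1" by linarith
  moreover have "card (I - G) = card I - card G"
    using I by (intro card_Diff_subset) (auto simp: G_def)
  \<comment> \<open>Parity decides: twice the number of bad words is at most the odd number
    \<open>2 * M - 1\<close>, so at most \<open>M - 1\<close> words are bad.\<close>
  ultimately have "M \<le> card G" using I M by linarith
  then obtain T where T: "T \<subseteq> G" "card T = M" "finite T"
    using obtain_subset_with_card_n by metis
  have "\<exists>h. bij_betw h {1..M} T"
    using T by (intro finite_same_card_bij) auto
  then obtain h where h: "bij_betw h {1..M} T" ..
  have "confusion W Y {1..M} (c \<circ> h) m \<le> 4 * real M powr \<rho> * A" if m: "m \<in> {1..M}" for m
  proof -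
    have "h m' \<in> I - {h m}" if "m' \<in> {1..M} - {m}" for m'
    proof -
      have "h m' \<in> T" using that h by (blast dest: bij_betwE)
      moreover have "h m' \<noteq> h m"
        using that m h by (auto simp: bij_betw_def dest: inj_onD)
      ultimately show ?thesis using T(1) by (auto simp: G_def)
    qed
    \<comment> \<open>Keeping only the words selected by \<open>h\<close> discards rivals, so no new
      output becomes confusing.\<close>
    then have "{y \<in> Y. \<exists>m'\<in>{1..M} - {m}. W (c (h m)) y \<le> W (c (h m')) y}
        \<subseteq> {y \<in> Y. \<exists>m'\<in>I - {h m}. W (c (h m)) y \<le> W (c m') y}" by blast
    then have "confusion W Y {1..M} (c \<circ> h) m \<le> confusion W Y I c (h m)"
      unfolding confusion_def comp_apply using fin W by (intro sum_mono2) simp_all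
    also have "h m \<in> G" using m h T(1) by (blast dest: bij_betwE)
    then have "confusion W Y I c (h m) \<le> 2 * B" by (simp add: G_def)
    also have "\<dots> = 2 powr (1 + \<rho>) * real M powr \<rho> * A"
      by (simp add: B_def powr_mult powr_add)
    also have "\<dots> \<le> 2 powr 2 * real M powr \<rho> * A"
      using A \<rho> by (intro mult_right_mono powr_mono) auto
    finally show ?thesis by simp
  qed
  then show ?thesis by blast
qed

text \<open>If the most likely word is not \<open>m\<close>, it is itself a rival counted by
  \<open>confusion\<close>, which includes ties; any choice among the maximisers will do.\<close>

lemma exists_maximum_likelihood_decoder:
  fixes W :: "'u \<Rightarrow> 'y \<Rightarrow> real"
  assumes W: "\<And>u y. W u y \<ge> 0" and fin: "finite Y" "finite I" and "I \<noteq> {}"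
  shows "\<exists>dec. (\<forall>y. dec y \<in> I) \<and>
    (\<forall>m\<in>I. (\<Sum>y | y \<in> Y \<and> dec y \<noteq> m. W (c m) y) \<le> confusion W Y I c m)"
proof -
  have "\<exists>m\<in>I. \<forall>m'\<in>I. W (c m') y \<le> W (c m) y" for y
  proof -
    have "Max ((\<lambda>m. W (c m) y) ` I) \<in> (\<lambda>m. W (c m) y) ` I"
      using assms by (intro Max_in) auto
    then obtain m where "m \<in> I" "W (c m) y = Max ((\<lambda>m. W (c m) y) ` I)" by auto
    then show ?thesis using fin by (intro bexI[of _ m]) auto
  qed
  then obtain dec where dec: "\<And>y. dec y \<in> I" "\<And>y m'. m' \<in> I \<Longrightarrow> W (c m') y \<le> W (c (dec y)) y"
    by metis
  have "(\<Sum>y | y \<in> Y \<and> dec y \<noteq> m. W (c m) y) \<le> confusion W Y I c m" if "m \<in> I" for m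
    unfolding confusion_def using dec W fin that by (intro sum_mono2) auto
  with dec show ?thesis by blast
qed

subsection \<open>Output law of the finite-state channel and random code trees\<close>

lemma input_prob_nonneg: "input_prob Q xs zs \<ge> 0"
  unfolding input_prob_def by (intro prod_nonneg) auto

lemma output_prob_nonneg: "output_prob P xs s0 ys \<ge> 0"
  unfolding output_prob_def by (intro sum_nonneg prod_nonneg) auto

lemma length_fsc_run: "(ys, s) \<in> set_pmf (fsc_run P z f s0 n) \<Longrightarrow> length ys = n"
  by (induction n arbitrary: ys s) auto

lemma pmf_fsc_run_Suc:
  fixes P :: "('x, 'y, 's::finite) fsc"
  shows "pmf (fsc_run P z f s0 (Suc n)) (ys @ [y], s') =
    (\<Sum>s\<in>UNIV. pmf (fsc_run P z f s0 n) (ys, s) * pmf (P (f (map z ys)) s) (y, s'))"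
proof -
  \<comment> \<open>The extended string determines its prefix, so a single earlier output string
    contributes.\<close>
  have *: "pmf (map_pmf (\<lambda>(y, s'). (ws @ [y], s')) p) (ys @ [y], s') =
      (if ws = ys then pmf p (y, s') else 0)" for ws and p :: "('y \<times> 's) pmf"
  proof (cases "ws = ys")
    case True
    have "inj (\<lambda>(y, s'). (ws @ [y], s'))" by (auto simp: inj_on_def)
    from pmf_map_inj'[OF this, of p "(y, s')"] True show ?thesis by simp
  next
    case False
    then show ?thesis by (auto simp: pmf_eq_0_set_pmf)
  qed
  have "pmf (fsc_run P z f s0 (Suc n)) (ys @ [y], s') =
    measure_pmf.expectation (fsc_run P z f s0 n)
      (\<lambda>(ws, s). if ws = ys then pmf (P (f (map z ws)) s) (y, s') else 0)"
    by (simp add: pmf_bind split_def *[unfolded split_def])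
  also have "\<dots> = (\<Sum>(ws, s)\<in>{ys} \<times> UNIV. pmf (P (f (map z ws)) s) (y, s') *
      pmf (fsc_run P z f s0 n) (ws, s))"
    by (subst integral_measure_pmf_real[where A = "{ys} \<times> UNIV"])
       (auto split: if_splits intro!: sum.cong)
  also have "\<dots> = (\<Sum>s\<in>UNIV. pmf (fsc_run P z f s0 n) (ys, s) * pmf (P (f (map z ys)) s) (y, s'))"
    by (simp add: mult.commute flip: sum.cartesian_product)
  finally show ?thesis .
qed

text \<open>Expansion over state paths. Fixing the end point of the path lets the induction append
  one transition; writing it as \<open>last (s0 # ss)\<close> covers the empty path.\<close>

lemma pmf_fsc_run:
  fixes P :: "('x, 'y, 's::finite) fsc"
  assumes "length ys = n"
  shows "pmf (fsc_run P z f s0 n) (ys, s) =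
    (\<Sum>ss | length ss = n \<and> last (s0 # ss) = s.
       \<Prod>i<n. pmf (P (f (map z (take i ys))) ((s0 # ss) ! i)) (ys ! i, ss ! i))"
  using assms
proof (induction n arbitrary: ys s)
  case 0
  have "{ss. length ss = 0 \<and> last (s0 # ss) = s} = (if s0 = s then {[]} else {})" by auto
  then show ?case using 0 by (simp add: indicator_def)
next
  case (Suc n)
  then obtain ys' y where ys: "ys = ys' @ [y]" "length ys' = n"
    by (metis length_Suc_conv_rev)
  define F where "F ss = (\<Prod>i<n. pmf (P (f (map z (take i ys'))) ((s0 # ss) ! i)) (ys' ! i, ss ! i))" for ss
  define q where "q t = pmf (P (f (map z ys')) t) (y, s)" for t
  have "pmf (fsc_run P z f s0 (Suc n)) (ys, s) =
      (\<Sum>t\<in>UNIV. (\<Sum>ss | length ss = n \<and> last (s0 # ss) = t. F ss) * q t)"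
    unfolding ys(1) pmf_fsc_run_Suc q_def F_def by (simp only: Suc.IH[OF ys(2)])
  \<comment> \<open>The state before the last channel use is the end point of the shorter path, so
    summing over \<open>t\<close> merely groups the paths.\<close>
  also have "\<dots> = (\<Sum>t\<in>UNIV. \<Sum>ss | ss \<in> {ss. length ss = n} \<and> last (s0 # ss) = t. F ss * q (last (s0 # ss)))"
    by (intro sum.cong refl) (simp add: sum_distrib_right)
  also have "\<dots> = (\<Sum>ss | length ss = n. F ss * q (last (s0 # ss)))"
    by (rule sum.group) auto
  also have "\<dots> = (\<Sum>ss | length ss = Suc n \<and> last (s0 # ss) = s.
       \<Prod>i<Suc n. pmf (P (f (map z (take i ys))) ((s0 # ss) ! i)) (ys ! i, ss ! i))"
  proof (rule sum.reindex_bij_witness[of _ butlast "\<lambda>ss. ss @ [s]"])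
    fix ss assume "ss \<in> {ss. length ss = Suc n \<and> last (s0 # ss) = s}"
    then have l: "length ss = Suc n" "last ss = s" "ss \<noteq> []" by (auto split: if_splits)
    then show "butlast ss @ [s] = ss" using append_butlast_last_id[of ss] by simp
  next
    fix ss assume "ss \<in> {ss :: 's list. length ss = n}"
    then have l: "length ss = n" by simp
    have nth: "(s0 # ss @ [s]) ! i = (s0 # ss) ! i" if "i \<le> n" for i
      using that l by (cases i) (auto simp: nth_append)
    have "(\<Prod>i<n. pmf (P (f (map z (take i ys))) ((s0 # ss @ [s]) ! i)) (ys ! i, (ss @ [s]) ! i)) = F ss"
      unfolding F_def by (intro prod.cong refl) (use l ys in \<open>simp add: nth nth_append\<close>)
    moreover have "(s0 # ss) ! n = last (s0 # ss)" using l by (cases ss rule: rev_cases) auto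
    ultimately show "(\<Prod>i<Suc n. pmf (P (f (map z (take i ys))) ((s0 # ss @ [s]) ! i)) (ys ! i, (ss @ [s]) ! i)) =
        F ss * q (last (s0 # ss))"
      using l ys nth[of n] by (simp add: q_def nth_append)
  qed auto
  finally show ?case .
qed

text \<open>A fixed output string fixes the feedback and hence all inputs. The loop thereby
  disappears, and summing out the final state leaves \<open>output_prob\<close>.\<close>

lemma error_prob_eq:
  fixes P :: "('x, 'y::finite, 's::finite) fsc"
  shows "error_prob P z N enc dec m s0 =
    (\<Sum>ys | length ys = N \<and> dec ys \<noteq> m.
       output_prob P (map (\<lambda>i. enc m (map z (take i ys))) [0..<N]) s0 ys)"
proof -
  let ?p = "fsc_run P z (enc m) s0 N"
  let ?D = "{ys. length ys = N \<and> dec ys \<noteq> m}"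
  have fin: "finite ?D" by (rule finite_subset[OF _ finite_lists_length[of N]]) auto
  have "error_prob P z N enc dec m s0 = measure_pmf.prob ?p (?D \<times> UNIV)"
    unfolding error_prob_def
    by (rule measure_prob_cong_0) (auto simp: pmf_eq_0_set_pmf dest: length_fsc_run)
  also have "\<dots> = (\<Sum>ys\<in>?D. \<Sum>s\<in>UNIV. pmf ?p (ys, s))"
    using fin by (subst measure_measure_pmf_finite) (auto simp: sum.cartesian_product)
  also have "\<dots> = (\<Sum>ys\<in>?D. output_prob P (map (\<lambda>i. enc m (map z (take i ys))) [0..<N]) s0 ys)"
  proof (rule sum.cong[OF refl])
    fix ys assume "ys \<in> ?D"
    then have "(\<Sum>s\<in>UNIV. pmf ?p (ys, s)) =
      (\<Sum>s\<in>UNIV. \<Sum>ss | ss \<in> {ss. length ss = N} \<and> last (s0 # ss) = s.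
        \<Prod>i<N. pmf (P (enc m (map z (take i ys))) ((s0 # ss) ! i)) (ys ! i, ss ! i))"
      by (simp add: pmf_fsc_run)
    also have "\<dots> = (\<Sum>ss | length ss = N.
        \<Prod>i<N. pmf (P (enc m (map z (take i ys))) ((s0 # ss) ! i)) (ys ! i, ss ! i))"
      by (rule sum.group) auto
    finally show "(\<Sum>s\<in>UNIV. pmf ?p (ys, s)) =
        output_prob P (map (\<lambda>i. enc m (map z (take i ys))) [0..<N]) s0 ys"
      by (simp add: output_prob_def)
  qed
  finally show ?thesis .
qed

text \<open>
  A code tree \<open>g\<close> chooses the next input from the past inputs and the past feedback.
  Drawing \<open>g (xs, zs)\<close> from \<open>Q xs zs\<close> independently for all histories makes the inputs along
  any fixed feedback string \<open>zs\<close> have the law \<open>input_prob Q _ zs\<close>.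
\<close>

primrec tree_inputs :: "('x list \<times> 'z list \<Rightarrow> 'x) \<Rightarrow> 'z list \<Rightarrow> nat \<Rightarrow> 'x list" where
  "tree_inputs g zs 0 = []"
| "tree_inputs g zs (Suc n) = tree_inputs g zs n @ [g (tree_inputs g zs n, take n zs)]"

text \<open>An encoder sees only the feedback; since the tree is deterministic, it can recompute its
  own past inputs.\<close>

definition tree_encoder :: "('x list \<times> 'z list \<Rightarrow> 'x) \<Rightarrow> 'z list \<Rightarrow> 'x" where
  "tree_encoder g zs = g (tree_inputs g zs (length zs), zs)"

lemma length_tree_inputs [simp]: "length (tree_inputs g zs n) = n"
  by (induction n) auto

lemma tree_inputs_take: "n \<le> k \<Longrightarrow> tree_inputs g (take k zs) n = tree_inputs g zs n"
  by (induction n) (auto simp: min_absorb1)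

lemma map_tree_encoder:
  "n \<le> length zs \<Longrightarrow> map (\<lambda>i. tree_encoder g (take i zs)) [0..<n] = tree_inputs g zs n"
  by (induction n) (auto simp: tree_encoder_def tree_inputs_take min_absorb2)

text \<open>Replaces a recursively defined event by conditions on single coordinates of
  \<open>g\<close>, so that independence of the coordinates applies.\<close>

lemma tree_inputs_eq_iff:
  "length xs = n \<Longrightarrow> tree_inputs g zs n = xs \<longleftrightarrow> (\<forall>i<n. g (take i xs, take i zs) = xs ! i)"
proof (induction n arbitrary: xs)
  case (Suc n)
  then obtain xs' x where xs: "xs = xs' @ [x]" "length xs' = n"
    by (metis length_Suc_conv_rev)
  show ?case using Suc.IH[OF xs(2)] xs(2) unfolding xs(1)
    by (auto simp: nth_append less_Suc_eq)
qed simp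

definition random_tree :: "nat \<Rightarrow> ('x list \<Rightarrow> 'z list \<Rightarrow> 'x pmf) \<Rightarrow> ('x list \<times> 'z list \<Rightarrow> 'x) pmf" where
  "random_tree N Q =
     Pi_pmf {(xs, zs). length xs < N \<and> length zs < N} undefined (\<lambda>(xs, zs). Q xs zs)"

lemma finite_histories:
  "finite {(xs :: 'x::finite list, zs :: 'z::finite list). length xs < N \<and> length zs < N}"
proof -
  have "finite {xs :: 'a::finite list. length xs < N}" for N
    using finite_lists_length_le[of "UNIV :: 'a set" N] by (rule rev_finite_subset) auto
  from finite_cartesian_product[OF this[of N, where 'a2 = 'x] this[of N, where 'a2 = 'z]]
  show ?thesis by (rule rev_finite_subset) auto
qed

lemma finite_set_random_tree:
  fixes Q :: "'x::finite list \<Rightarrow> 'z::finite list \<Rightarrow> 'x pmf"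
  shows "finite (set_pmf (random_tree N Q))"
  unfolding random_tree_def by (intro finite_set_Pi_pmf finite_histories) simp

text \<open>The event is a rectangle: \<open>g\<close> is prescribed at the \<open>N\<close>
  histories along \<open>xs\<close> and free elsewhere. These histories are distinct because their
  lengths differ, so the probability is a product of \<open>N\<close> factors.\<close>

lemma prob_random_tree:
  fixes Q :: "'x::finite list \<Rightarrow> 'z::finite list \<Rightarrow> 'x pmf"
  assumes xs: "length xs = N"
  shows "measure_pmf.prob (random_tree N Q) {g. tree_inputs g zs N = xs} = input_prob Q xs zs"
proof -
  let ?K = "{(xs :: 'x list, zs :: 'z list). length xs < N \<and> length zs < N}"
  define k where "k i = (take i xs, take i zs)" for i
  have inj: "inj_on k {..<N}"
    unfolding k_def
  proof (rule inj_onI)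
    fix i j assume "i \<in> {..<N}" "j \<in> {..<N}" "(take i xs, take i zs) = (take j xs, take j zs)"
    then have "length (take i xs) = length (take j xs)" by simp
    then show "i = j" using xs \<open>i \<in> {..<N}\<close> \<open>j \<in> {..<N}\<close> by simp
  qed
  have sub: "k ` {..<N} \<subseteq> ?K" using xs by (auto simp: k_def)
  define B where "B c = (if c \<in> k ` {..<N} then {xs ! the_inv_into {..<N} k c} else UNIV)" for c
  have B: "B (k i) = {xs ! i}" if "i < N" for i
    using that inj by (simp add: B_def the_inv_into_f_f)
  have "{g. tree_inputs g zs N = xs} = Pi ?K B"
  proof -
    have "tree_inputs g zs N = xs \<longleftrightarrow> (\<forall>i<N. g (k i) \<in> B (k i))" for g
      using tree_inputs_eq_iff[OF xs, of g zs] B by (simp add: k_def)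
    moreover have "(\<forall>i<N. g (k i) \<in> B (k i)) \<longleftrightarrow> g \<in> Pi ?K B" for g
    proof
      assume "\<forall>i<N. g (k i) \<in> B (k i)"
      then have "g c \<in> B c" for c
        by (cases "c \<in> k ` {..<N}") (auto, simp add: B_def)
      then show "g \<in> Pi ?K B" by blast
    qed (use sub in \<open>auto simp: Pi_def\<close>)
    ultimately show ?thesis by blast
  qed
  then have "measure_pmf.prob (random_tree N Q) {g. tree_inputs g zs N = xs} =
      (\<Prod>c\<in>?K. measure_pmf.prob (case c of (xs, zs) \<Rightarrow> Q xs zs) (B c))"
    by (simp only: random_tree_def measure_Pi_pmf_Pi finite_histories)
  also have "\<dots> = (\<Prod>c\<in>k ` {..<N}. measure_pmf.prob (case c of (xs, zs) \<Rightarrow> Q xs zs) (B c))"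
    by (rule prod.mono_neutral_right[OF finite_histories sub]) (simp add: B_def)
  also have "\<dots> = (\<Prod>i<N. measure_pmf.prob (case k i of (xs, zs) \<Rightarrow> Q xs zs) (B (k i)))"
    by (simp add: prod.reindex[OF inj])
  also have "\<dots> = (\<Prod>i<N. pmf (Q (take i xs) (take i zs)) (xs ! i))"
    by (intro prod.cong refl) (simp add: B, simp add: k_def measure_pmf_single)
  finally show ?thesis using xs by (simp add: input_prob_def)
qed

lemma expectation_random_tree:
  fixes Q :: "'x::finite list \<Rightarrow> 'z::finite list \<Rightarrow> 'x pmf" and h :: "'x list \<Rightarrow> real"
  shows "measure_pmf.expectation (random_tree N Q) (\<lambda>g. h (tree_inputs g zs N)) =
    (\<Sum>xs | length xs = N. input_prob Q xs zs * h xs)"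
proof -
  let ?t = "\<lambda>g. tree_inputs g zs N"
  have "measure_pmf.expectation (random_tree N Q) (\<lambda>g. h (?t g)) =
      measure_pmf.expectation (map_pmf ?t (random_tree N Q)) h" by simp
  also have "\<dots> = (\<Sum>xs | length xs = N. h xs * pmf (map_pmf ?t (random_tree N Q)) xs)"
    by (rule integral_measure_pmf_real) auto
  also have "\<dots> = (\<Sum>xs | length xs = N. input_prob Q xs zs * h xs)"
    by (intro sum.cong refl) (simp add: pmf_map vimage_def prob_random_tree)
  finally show ?thesis .
qed

section \<open>The error exponent of the averaged channel\<close>

text \<open>The last factor reads only \<open>length xs - 1\<close> feedback symbols. This
  reconciles the truncated string in \<open>Eo\<close> with the full feedback string seen by a
  tree.\<close>

lemma input_prob_take: "input_prob Q xs (take (length xs - 1) zs) = input_prob Q xs zs"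
  unfolding input_prob_def by (intro prod.cong refl) (simp add: min_absorb1)

lemma Eo_powr:
  fixes P :: "('x::finite, 'y::finite, 's::finite) fsc" and Q :: "'x list \<Rightarrow> 'z list \<Rightarrow> 'x pmf"
  assumes "N > 0"
  shows "(\<Sum>ys | length ys = N. (\<Sum>xs | length xs = N.
            input_prob Q xs (map z ys) *
            output_prob P xs s0 ys powr (1 / (1 + \<rho>))) powr (1 + \<rho>)) =
    2 powr (- real N * Eo P z N \<rho> Q s0)" (is "?Z = _")
proof -
  have eq: "?Z = (\<Sum>ys | length ys = N. (\<Sum>xs | length xs = N.
            input_prob Q xs (map z (take (N - 1) ys)) *
            output_prob P xs s0 ys powr (1 / (1 + \<rho>))) powr (1 + \<rho>))"
  proof (intro sum.cong refl arg_cong2[where f = "(powr)"] arg_cong2[where f = "(*)"])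
    fix ys :: "'y list" and xs :: "'x list"
    assume "xs \<in> {xs. length xs = N}"
    then show "input_prob Q xs (map z ys) = input_prob Q xs (map z (take (N - 1) ys))"
      using input_prob_take[of Q xs "map z ys"] by (simp add: take_map)
  qed
  have "?Z > 0" unfolding eq by (rule Eo_arg_pos)
  then show ?thesis using assms unfolding eq Eo_def by simp
qed

text \<open>Bookkeeping of the powers of \<open>n\<close>: the average over initial states gives
  \<open>1 / n\<close>, because \<open>\<theta> * (1 + \<rho>) = 1\<close>; the power mean
  inequality gives \<open>n powr \<rho>\<close>; bounding each of the \<open>n\<close> summands by
  the worst state gives \<open>n\<close>.\<close>

lemma averaged_channel_bound:
  fixes P :: "('x::finite, 'y::finite, 's::finite) fsc" and Q :: "'x list \<Rightarrow> 'z::finite list \<Rightarrow> 'x pmf"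
  assumes N: "N > 0" and \<rho>: "0 \<le> \<rho>"
  shows "(\<Sum>ys | length ys = N. measure_pmf.expectation (random_tree N Q)
      (\<lambda>g. ((\<Sum>s0\<in>UNIV. output_prob P (tree_inputs g (map z ys) N) s0 ys) / real CARD('s))
        powr (1 / (1 + \<rho>))) powr (1 + \<rho>))
    \<le> real CARD('s) powr \<rho> * 2 powr (- real N * (MIN s0. Eo P z N \<rho> Q s0))"
proof -
  define n where "n = real CARD('s)"
  have n: "n > 0" by (simp add: n_def)
  define \<theta> where "\<theta> = 1 / (1 + \<rho>)"
  have \<theta>: "0 \<le> \<theta>" "\<theta> \<le> 1" "\<theta> * (1 + \<rho>) = 1" using \<rho> by (auto simp: \<theta>_def)
  define b where "b s0 ys = (\<Sum>xs | length xs = N. input_prob Q xs (map z ys) * output_prob P xs s0 ys powr \<theta>)" for s0 ys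
  have b: "b s0 ys \<ge> 0" for s0 ys
    unfolding b_def by (intro sum_nonneg mult_nonneg_nonneg input_prob_nonneg) auto
  have ys: "measure_pmf.expectation (random_tree N Q)
      (\<lambda>g. ((\<Sum>s0\<in>UNIV. output_prob P (tree_inputs g (map z ys) N) s0 ys) / n) powr \<theta>) powr (1 + \<rho>)
    \<le> n powr (\<rho> - 1) * (\<Sum>s0\<in>UNIV. b s0 ys powr (1 + \<rho>))" for ys
  proof -
    have "measure_pmf.expectation (random_tree N Q)
        (\<lambda>g. ((\<Sum>s0\<in>UNIV. output_prob P (tree_inputs g (map z ys) N) s0 ys) / n) powr \<theta>)
      = (\<Sum>xs | length xs = N. input_prob Q xs (map z ys) *
          ((\<Sum>s0\<in>UNIV. output_prob P xs s0 ys) / n) powr \<theta>)" (is "?E = _")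
      by (rule expectation_random_tree)
    also have "\<dots> \<le> (\<Sum>xs | length xs = N. input_prob Q xs (map z ys) *
          ((\<Sum>s0\<in>UNIV. output_prob P xs s0 ys powr \<theta>) / n powr \<theta>))"
    proof (intro sum_mono mult_left_mono input_prob_nonneg)
      fix xs
      have "((\<Sum>s0\<in>UNIV. output_prob P xs s0 ys) / n) powr \<theta> =
          (\<Sum>s0\<in>UNIV. output_prob P xs s0 ys) powr \<theta> / n powr \<theta>"
        using n by (simp add: powr_divide sum_nonneg output_prob_nonneg)
      also have "\<dots> \<le> (\<Sum>s0\<in>UNIV. output_prob P xs s0 ys powr \<theta>) / n powr \<theta>"
        using \<theta> by (intro divide_right_mono powr_sum_le_sum_powr output_prob_nonneg) auto
      finally show "((\<Sum>s0\<in>UNIV. output_prob P xs s0 ys) / n) powr \<theta>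
        \<le> (\<Sum>s0\<in>UNIV. output_prob P xs s0 ys powr \<theta>) / n powr \<theta>" .
    qed
    also have "\<dots> = (\<Sum>s0\<in>UNIV. b s0 ys) / n powr \<theta>"
      unfolding b_def by (subst sum.swap) (simp add: sum_distrib_left sum_divide_distrib)
    finally have "?E powr (1 + \<rho>) \<le> ((\<Sum>s0\<in>UNIV. b s0 ys) / n powr \<theta>) powr (1 + \<rho>)"
      using \<rho> by (intro powr_mono2 integral_nonneg_AE) auto
    also have "\<dots> = (\<Sum>s0\<in>UNIV. b s0 ys) powr (1 + \<rho>) / n"
      using n b \<theta>(3) by (simp add: powr_divide powr_powr sum_nonneg)
    also have "\<dots> \<le> (n powr \<rho> * (\<Sum>s0\<in>UNIV. b s0 ys powr (1 + \<rho>))) / n"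
      using n b \<rho> unfolding n_def by (intro divide_right_mono powr_sum_le_card_powr) auto
    also have "\<dots> = n powr (\<rho> - 1) * (\<Sum>s0\<in>UNIV. b s0 ys powr (1 + \<rho>))"
      using n by (simp add: powr_diff)
    finally show ?thesis .
  qed
  have "(\<Sum>ys | length ys = N. measure_pmf.expectation (random_tree N Q)
      (\<lambda>g. ((\<Sum>s0\<in>UNIV. output_prob P (tree_inputs g (map z ys) N) s0 ys) / n) powr \<theta>) powr (1 + \<rho>))
    \<le> (\<Sum>ys | length ys = N. n powr (\<rho> - 1) * (\<Sum>s0\<in>UNIV. b s0 ys powr (1 + \<rho>)))"
    by (intro sum_mono ys)
  also have "\<dots> = n powr (\<rho> - 1) * (\<Sum>s0\<in>UNIV. \<Sum>ys | length ys = N. b s0 ys powr (1 + \<rho>))"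
    by (subst sum.swap) (simp add: sum_distrib_left)
  also have "\<dots> = n powr (\<rho> - 1) * (\<Sum>s0\<in>UNIV. 2 powr (- real N * Eo P z N \<rho> Q s0))"
    using Eo_powr[OF N, of Q z P _ \<rho>] by (simp add: b_def \<theta>_def)
  also have "\<dots> \<le> n powr (\<rho> - 1) * (\<Sum>s0\<in>(UNIV::'s set). 2 powr (- real N * (MIN s0. Eo P z N \<rho> Q s0)))"
  proof (rule mult_left_mono[OF sum_mono])
    fix s0 :: 's
    have "- real N * Eo P z N \<rho> Q s0 \<le> - real N * (MIN s0. Eo P z N \<rho> Q s0)"
      by (rule mult_left_mono_neg) auto
    then show "2 powr (- real N * Eo P z N \<rho> Q s0) \<le> 2 powr (- real N * (MIN s0. Eo P z N \<rho> Q s0))"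
      by (rule powr_mono) simp
  qed simp
  also have "\<dots> = n powr (\<rho> - 1) * n * 2 powr (- real N * (MIN s0. Eo P z N \<rho> Q s0))"
    by (simp add: n_def)
  also have "n powr (\<rho> - 1) * n = n powr \<rho>" using n by (simp add: powr_diff)
  finally show ?thesis by (simp add: n_def \<theta>_def)
qed

text \<open>Since the supremum is attained, some \<open>Q\<close> reaches \<open>FN\<close> exactly,
  with no loss of an epsilon. The factor \<open>CARD('s) powr \<rho>\<close> is the logarithmic term
  of \<open>FN\<close>.\<close>

lemma FN_powr:
  fixes P :: "('x::finite, 'y::finite, 's::finite) fsc" and z :: "'y \<Rightarrow> 'z"
  assumes "N > 0" "0 \<le> \<rho>"
  shows "\<exists>Q. real CARD('s) powr \<rho> * 2 powr (- real N * (MIN s0. Eo P z N \<rho> Q s0)) =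
    2 powr (- real N * FN P z N \<rho>)"
proof -
  obtain Q where Q: "\<And>Q'. (MIN s0. Eo P z N \<rho> Q' s0) \<le> (MIN s0. Eo P z N \<rho> Q s0)"
    using Eo_max_attained[OF \<open>0 \<le> \<rho>\<close>] by blast
  have "(SUP Q. MIN s0. Eo P z N \<rho> Q s0) = (MIN s0. Eo P z N \<rho> Q s0)"
    using Q by (intro cSup_eq_maximum) auto
  then have "- real N * FN P z N \<rho> =
      \<rho> * log 2 (real CARD('s)) + - real N * (MIN s0. Eo P z N \<rho> Q s0)"
    using \<open>N > 0\<close> by (simp add: FN_def field_simps)
  then have "2 powr (- real N * FN P z N \<rho>) =
      (2 powr log 2 (real CARD('s))) powr \<rho> * 2 powr (- real N * (MIN s0. Eo P z N \<rho> Q s0))"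
    by (simp only: powr_add powr_powr mult.commute)
  then show ?thesis by (intro exI[of _ Q]) simp
qed

text \<open>The code may still depend on \<open>\<rho>\<close>, through the optimal \<open>Q\<close>
  and through the codebook selected.\<close>

lemma exists_code_for_parameter:
  fixes P :: "('x::finite, 'y::finite, 's::finite) fsc" and z :: "'y \<Rightarrow> 'z::finite"
  assumes N: "N > 0" and M: "M \<ge> 1" and \<rho>: "0 \<le> \<rho>" "\<rho> \<le> 1"
  shows "\<exists>enc dec. is_code N M enc dec \<and> (\<forall>m\<in>{1..M}. \<forall>s0. error_prob P z N enc dec m s0
    \<le> 4 * real CARD('s) * real M powr \<rho> * 2 powr (- real N * FN P z N \<rho>))"
proof -
  obtain Q :: "'x list \<Rightarrow> 'z list \<Rightarrow> 'x pmf" where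
    Q: "real CARD('s) powr \<rho> * 2 powr (- real N * (MIN s0. Eo P z N \<rho> Q s0)) =
      2 powr (- real N * FN P z N \<rho>)"
    using FN_powr[OF N \<rho>(1)] by metis
  define n where "n = real CARD('s)"
  have n: "n > 0" by (simp add: n_def)
  define W where "W g ys = (\<Sum>s0\<in>UNIV. output_prob P (tree_inputs g (map z ys) N) s0 ys) / n"
    for g :: "'x list \<times> 'z list \<Rightarrow> 'x" and ys
  have W: "W g ys \<ge> 0" for g ys
    using n unfolding W_def by (intro divide_nonneg_pos sum_nonneg output_prob_nonneg)
  define A where "A = 2 powr (- real N * FN P z N \<rho>)"
  have "\<exists>c. \<forall>m\<in>{1..M}. confusion W {ys. length ys = N} {1..M} c m \<le> 4 * real M powr \<rho> * A"
  proof (rule exists_code_confusion_le[where p = "random_tree N Q"])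
    show "(\<Sum>ys | length ys = N. measure_pmf.expectation (random_tree N Q)
        (\<lambda>g. W g ys powr (1 / (1 + \<rho>))) powr (1 + \<rho>)) \<le> A"
      using averaged_channel_bound[OF N \<rho>(1), of Q P z] by (simp only: A_def W_def n_def Q)
  qed (use W M \<rho> in \<open>auto simp: A_def finite_set_random_tree\<close>)
  then obtain c where c: "\<And>m. m \<in> {1..M} \<Longrightarrow>
      confusion W {ys. length ys = N} {1..M} c m \<le> 4 * real M powr \<rho> * A" by blast
  obtain dec where dec: "\<And>ys. dec ys \<in> {1..M}" "\<And>m. m \<in> {1..M} \<Longrightarrow>
      (\<Sum>ys | ys \<in> {ys. length ys = N} \<and> dec ys \<noteq> m. W (c m) ys)
        \<le> confusion W {ys. length ys = N} {1..M} c m"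
  proof -
    have "{1..M} \<noteq> {}" using M by simp
    from exists_maximum_likelihood_decoder[of W, OF W finite_lists_length[of N] finite_atLeastAtMost this, of c]
    show ?thesis using that by blast
  qed
  have "error_prob P z N (\<lambda>m. tree_encoder (c m)) dec m s0 \<le> 4 * n * real M powr \<rho> * A"
    if m: "m \<in> {1..M}" for m s0
  proof -
    have "error_prob P z N (\<lambda>m. tree_encoder (c m)) dec m s0 =
      (\<Sum>ys | length ys = N \<and> dec ys \<noteq> m. output_prob P (tree_inputs (c m) (map z ys) N) s0 ys)"
      unfolding error_prob_eq
      by (intro sum.cong refl) (simp flip: take_map add: map_tree_encoder)
    also have "\<dots> \<le> (\<Sum>ys | length ys = N \<and> dec ys \<noteq> m. n * W (c m) ys)"
    \<comment> \<open>The true initial state is one of the \<open>n\<close> nonnegative summands in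
      \<open>n * W (c m) ys\<close>.\<close>
    proof (rule sum_mono)
      fix ys
      show "output_prob P (tree_inputs (c m) (map z ys) N) s0 ys \<le> n * W (c m) ys"
        using n member_le_sum[of s0 UNIV "\<lambda>s0. output_prob P (tree_inputs (c m) (map z ys) N) s0 ys"]
        by (simp add: W_def output_prob_nonneg)
    qed
    also have "\<dots> \<le> n * (4 * real M powr \<rho> * A)"
      using n order.trans[OF dec(2)[OF m] c[OF m]] by (simp flip: sum_distrib_left)
    finally show ?thesis by (simp add: mult_ac)
  qed
  moreover have "is_code N M (\<lambda>m. tree_encoder (c m)) dec" using dec(1) by (simp add: is_code_def)
  ultimately show ?thesis unfolding A_def n_def by blast
qed

section \<open>One code for all values of \<open>\<rho>\<close>\<close>

lemma error_prob_cong: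
  fixes P :: "('x, 'y::finite, 's::finite) fsc"
  assumes "\<And>zs. length zs < N \<Longrightarrow> enc m zs = enc' m zs" "\<And>ys. length ys = N \<Longrightarrow> dec ys = dec' ys"
  shows "error_prob P z N enc dec m s0 = error_prob P z N enc' dec' m s0"
  unfolding error_prob_eq
  by (intro sum.cong arg_cong2[where f = "\<lambda>xs. output_prob P xs s0"] map_cong) (use assms in auto)

text \<open>
  Only finitely many codes differ on the arguments that matter, so a code with the least worst-case
  error exists; it satisfies every uniform bound that some code satisfies, hence the bounds for all
  \<open>\<rho>\<close> at once.
\<close>

lemma exists_code_minimising_worst_error:
  fixes P :: "('x::finite, 'y::finite, 's::finite) fsc" and z :: "'y \<Rightarrow> 'z::finite"
  assumes "M \<ge> 1"
  shows "\<exists>enc dec. is_code N M enc dec \<and> (\<forall>enc' dec' B. is_code N M enc' dec' \<longrightarrow>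
    (\<forall>m\<in>{1..M}. \<forall>s0. error_prob P z N enc' dec' m s0 \<le> B) \<longrightarrow>
    (\<forall>m\<in>{1..M}. \<forall>s0. error_prob P z N enc dec m s0 \<le> B))"
proof -
  define w where "w = (\<lambda>(enc, dec). Max ((\<lambda>(m, s0). error_prob P z N enc dec m s0) ` ({1..M} \<times> UNIV)))"
  have w_le: "w (enc, dec) \<le> B \<longleftrightarrow> (\<forall>m\<in>{1..M}. \<forall>s0. error_prob P z N enc dec m s0 \<le> B)" for enc dec B
    using assms unfolding w_def split by (subst Max_le_iff) auto
  define C :: "((nat \<Rightarrow> 'z list \<Rightarrow> 'x) \<times> ('y list \<Rightarrow> nat)) set"
    where "C = {c. is_code N M (fst c) (snd c)}"
  define F where "F = (({1..M} \<times> {zs :: 'z list. length zs < N}) \<rightarrow>\<^sub>E (UNIV :: 'x set)) \<times>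
    ({ys :: 'y list. length ys = N} \<rightarrow>\<^sub>E {1..M})"
  have "finite {zs :: 'z list. length zs < N}"
    using finite_lists_length_le[of "UNIV :: 'z set" N] by (rule rev_finite_subset) auto
  then have "finite F" unfolding F_def by (intro finite_cartesian_product finite_PiE) auto
  \<comment> \<open>Restricting a code to the relevant arguments keeps its worst error, so the
    finite set \<open>F\<close> already produces every value of \<open>w\<close> on codes.\<close>
  moreover have "w ` C \<subseteq> (\<lambda>(e, d). w (curry e, d)) ` F"
  proof (rule image_subsetI)
    fix c assume "c \<in> C"
    obtain enc dec where c: "c = (enc, dec)" by fastforce
    define e where "e = restrict (\<lambda>(m, zs). enc m zs) ({1..M} \<times> {zs. length zs < N})"
    define d where "d = restrict dec {ys. length ys = N}"
    have "error_prob P z N enc dec m s0 = error_prob P z N (curry e) d m s0" if "m \<in> {1..M}" for m s0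
      by (rule error_prob_cong) (use that in \<open>auto simp: e_def d_def\<close>)
    then have "w c = w (curry e, d)"
      unfolding w_def c split by (intro arg_cong[where f = Max] image_cong) auto
    moreover have "(e, d) \<in> F"
      using \<open>c \<in> C\<close> by (auto simp: F_def e_def d_def C_def c is_code_def)
    ultimately show "w c \<in> (\<lambda>(e, d). w (curry e, d)) ` F" by force
  qed
  ultimately have fin: "finite (w ` C)" by (meson finite_imageI finite_subset)
  \<comment> \<open>The constant decoder 1 is admissible because \<open>M \<ge> 1\<close>, so the
    minimum is over a nonempty set.\<close>
  have "(\<lambda>m zs. undefined, \<lambda>ys. 1) \<in> C" using assms by (simp add: C_def is_code_def)
  then have "w ` C \<noteq> {}" by blast
  from Min_in[OF fin this] obtain c where c: "c \<in> C" "w c = Min (w ` C)" by force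
  obtain enc dec where ed: "c = (enc, dec)" by fastforce
  have min: "w (enc, dec) \<le> w (enc', dec')" if "is_code N M enc' dec'" for enc' dec'
  proof -
    have "(enc', dec') \<in> C" using that by (simp add: C_def)
    then show ?thesis using c(2) fin unfolding ed by (simp add: Min_le)
  qed
  have "is_code N M enc dec" using c(1) by (simp add: C_def ed)
  then show ?thesis unfolding w_le[symmetric] by (blast intro: min order.trans)
qed

theorem theorem9:
  fixes P :: "('x::finite, 'y::finite, 's::finite) fsc"
    and z :: "'y \<Rightarrow> 'z::finite"
    and N :: nat and R :: real
  assumes "N > 0" and "R > 0"
  shows "\<exists>enc dec. is_code N (nat \<lfloor>2 powr (real N * R)\<rfloor>) enc dec \<and>
    (\<forall>m\<in>{1..nat \<lfloor>2 powr (real N * R)\<rfloor>}. \<forall>s0. \<forall>\<rho>\<in>{0..1}.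
       error_prob P z N enc dec m s0
         \<le> 4 * real CARD('s) * 2 powr (- real N * (- \<rho> * R + FN P z N \<rho>)))"
proof -
  define M where "M = nat \<lfloor>2 powr (real N * R)\<rfloor>"
  have "1 \<le> 2 powr (real N * R)" using assms by (simp add: ge_one_powr_ge_zero)
  then have M: "M \<ge> 1" "real M \<le> 2 powr (real N * R)" by (auto simp: M_def le_nat_iff le_floor_iff)
  obtain enc dec where code: "is_code N M enc dec" and
    opt: "\<And>enc' dec' B. is_code N M enc' dec' \<Longrightarrow>
      \<forall>m\<in>{1..M}. \<forall>s0. error_prob P z N enc' dec' m s0 \<le> B \<Longrightarrow>
      \<forall>m\<in>{1..M}. \<forall>s0. error_prob P z N enc dec m s0 \<le> B"
    using exists_code_minimising_worst_error[OF M(1), of N P z] by blast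
  have "error_prob P z N enc dec m s0
      \<le> 4 * real CARD('s) * 2 powr (- real N * (- \<rho> * R + FN P z N \<rho>))"
    if m: "m \<in> {1..M}" and \<rho>: "\<rho> \<in> {0..1}" for m s0 \<rho>
  proof -
    \<comment> \<open>The code built for this \<open>\<rho>\<close> serves only as a competitor: its
      bound, uniform in \<open>m\<close> and \<open>s0\<close>, passes to the optimal code, which
      was fixed before \<open>\<rho>\<close>.\<close>
    have "error_prob P z N enc dec m s0
        \<le> 4 * real CARD('s) * real M powr \<rho> * 2 powr (- real N * FN P z N \<rho>)"
      using exists_code_for_parameter[OF assms(1) M(1), of \<rho> P z] opt m \<rho> by fastforce
    \<comment> \<open>Rounding down makes \<open>M\<close> at most
      \<open>2 powr (real N * R)\<close>, and \<open>\<rho> \<ge> 0\<close> keeps the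
      direction.\<close>
    also have "\<dots> \<le> 4 * real CARD('s) * (2 powr (real N * R)) powr \<rho> * 2 powr (- real N * FN P z N \<rho>)"
      using M \<rho> by (intro mult_right_mono mult_left_mono powr_mono2) auto
    also have "\<dots> = 4 * real CARD('s) * 2 powr (- real N * (- \<rho> * R + FN P z N \<rho>))"
      by (simp add: powr_powr algebra_simps flip: powr_add)
    finally show ?thesis .
  qed
  with code show ?thesis unfolding M_def by blast
qed

end
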